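(* Let $n\ge 1$, let $0<\rho<1$ be real and let $\beta\ge 1$ be an integer. Write $\lg x=\lceil\log_2 x\rceil$. If algorithm OF-SRR is executed by $n$ stations on a multiple access channel without jamming and with collision detection, against any leaky-bucket adversary of type $(\rho,\beta)$, then in every round the total number of packets queued in the stations is at most $$\frac{4\rho}{1-\rho}\cdot n+\beta$$ and packet latency is at most $$\frac{4}{1-\rho}\cdot n+\beta(1+\rho).$$ Moreover, if $\rho\le\frac{1}{2+\lg n}$ then in every round the total number of packets queued in the stations is at most $2\beta$ and packet latency is at most $2\beta(2+\lg n)$.
   Context: Channel. There are $n$ stations with distinct names $0,1,\dots,n-1$ attached to a shared channel; $n$ and own names are known to the stations. Time is divided into synchronous rounds numbered from $0$; all stations start in round $0$ with empty queues. In each round each station either transmits one message (containing at most one packet) or pauses. A message is heard (by all stations) in a round iff it is the only message transmitted in that round. With collision detection, all stations learn in each round whether a message was heard, or nobody transmitted (silence), or at least two stations transmitted (collision). Within a round the order is: transmissions, feedback, injection of new packets (enqueued into private unbounded FIFO queues), local state change. A packet is removed from its queue once heard, and never dropped before. Adversary of type $(\rho,\beta)$: in each contiguous segment of $t>0$ rounds it injects at most $\rho t+\beta$ packets, into arbitrary stations. Packet latency: an upper bound on the number of rounds a packet spends waiting, counted from the round of injection through the round in which it is heard, over all executions against such adversaries. Algorithm OF-SRR (Old-First-Search-Round-Robin): the execution is a sequence of consecutive phases. In a given phase, packets injected in the previous phase are old and packets injected in the current phase are new; in the first phase there are no old packets. Only old packets are eligible for transmission. All stations maintain identical copies of a stack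 of intervals of names. A phase starts with the stack containing only the interval $[0,n-1]$. To process an interval (obtained by popping the stack), all stations with names in the interval that have old packets transmit in one round. If the result is silence, the interval is discarded. If a packet is heard, the unique transmitting station withholds the channel and transmits all its remaining old packets in consecutive rounds, after which there is one silent round and the interval is done. If the result is a collision, the interval is split into two halves (as equal as possible); one half (the one with lower names) is processed immediately next and the other is pushed on the stack. When an interval has been discarded or done, the next one is popped from the stack; the phase ends when the stack is empty and nothing remains to be processed, and the next phase begins immediately. *)

theory Defs
  imports Complex_Main
begin

definition lg :: "real \<Rightarrow> int" where
  "lg x = \<lceil>log 2 x\<rceil>"

text \<open>
  An injection pattern \<open>adv\<close> gives, for every round \<open>t\<close> and every station \<open>i < n\<close>, the number
  \<open>adv t i\<close> of packets put into the queue of \<open>i\<close> in round \<open>t\<close>; values at \<open>i \<ge> n\<close> play no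
  role.  The algorithm is deterministic, so an execution against an adaptive adversary is
  the execution determined by the pattern that the adversary ends up injecting.
\<close>

definition leaky_bucket :: "real \<Rightarrow> real \<Rightarrow> nat \<Rightarrow> (nat \<Rightarrow> nat \<Rightarrow> nat) \<Rightarrow> bool" where
  "leaky_bucket \<rho> \<beta> n adv \<longleftrightarrow>
     (\<forall>s t. t > 0 \<longrightarrow> real (\<Sum>r\<in>{s..<s + t}. \<Sum>i<n. adv r i) \<le> \<rho> * real t + \<beta>)"

text \<open>Packets have an identity: number \<open>index\<close> (from 0) among those injected in round \<open>born\<close> into station \<open>home\<close>.\<close>

datatype packet = Packet (born: nat) (home: nat) (index: nat)

definition injected :: "nat \<Rightarrow> (nat \<Rightarrow> nat \<Rightarrow> nat) \<Rightarrow> packet set" where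
  "injected n adv = {p. home p < n \<and> index p < adv (born p) (home p)}"

datatype feedback = Silence | Heard nat | Collision

definition channel :: "nat set \<Rightarrow> feedback" where
  "channel T = (if T = {} then Silence
                else if card T = 1 then Heard (the_elem T)
                else Collision)"

text \<open>The pair \<open>(a, b)\<close> stands for the interval of names \<open>{a..b}\<close>.\<close>

type_synonym interval = "nat \<times> nat"

text \<open>
  An interval \<open>{a..b}\<close> with \<open>a < b\<close> is split into \<open>{a..mid a b}\<close> and \<open>{Suc (mid a b)..b}\<close>.
  When the number of names is odd, either half may be the larger one, and \<open>mid\<close> decides which.
\<close>

definition halving :: "(nat \<Rightarrow> nat \<Rightarrow> nat) \<Rightarrow> bool" where
  "halving mid \<longleftrightarrow>
     (\<forall>a b. a < b \<longrightarrow> a \<le> mid a b \<and> mid a b < b \<and>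
        \<bar>int (card {a..mid a b}) - int (card {Suc (mid a b)..b})\<bar> \<le> 1)"

text \<open>
  Configuration at the beginning of a round.  The identical copies of the stack kept by the
  stations are represented by one stack; its top is the interval processed next.
  \<open>holder\<close> is the station withholding the channel, if any; a station is its holder exactly if it
  transmitted when a packet was heard.  \<open>cur_start\<close> and \<open>prev_start\<close> are the first rounds of the
  current and the previous phase (equal during the first phase, which has no predecessor).
\<close>

record config =
  queue :: "nat \<Rightarrow> packet list"
  stack :: "interval list"
  holder :: "nat option"
  prev_start :: nat
  cur_start :: nat

definition old :: "config \<Rightarrow> packet \<Rightarrow> bool" where
  "old c p \<longleftrightarrow> prev_start c \<le> born p \<and> born p < cur_start c"

definition old_queue :: "config \<Rightarrow> nat \<Rightarrow> packet list" where
  "old_queue c i = filter (old c) (queue c i)"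

definition may_transmit :: "config \<Rightarrow> nat \<Rightarrow> bool" where
  "may_transmit c i =
     (case holder c of
        Some j \<Rightarrow> i = j
      | None \<Rightarrow> (case stack c of
                  [] \<Rightarrow> False
                | (a, b) # S \<Rightarrow> i \<in> {a..b}))"

definition transmitters :: "nat \<Rightarrow> config \<Rightarrow> nat set" where
  "transmitters n c = {i \<in> {..<n}. may_transmit c i \<and> old_queue c i \<noteq> []}"

definition heard :: "nat \<Rightarrow> config \<Rightarrow> packet option" where
  "heard n c =
     (case channel (transmitters n c) of
        Heard i \<Rightarrow> Some (hd (old_queue c i))
      | _ \<Rightarrow> None)"

text \<open>
  Effect of the feedback on the stack and the holder.  A holder keeps the channel until it has
  been silent for one round.  Configurations outside the four cases of the algorithm (a collision
  while the channel is withheld, an empty stack without a holder) do not arise in an execution.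
\<close>

definition control_step ::
  "(nat \<Rightarrow> nat \<Rightarrow> nat) \<Rightarrow> feedback \<Rightarrow> interval list \<Rightarrow> nat option \<Rightarrow> interval list \<times> nat option" where
  "control_step mid f S h =
     (case h of
        Some j \<Rightarrow> (S, if f = Silence then None else Some j)
      | None \<Rightarrow>
          (case S of
             [] \<Rightarrow> ([], None)
           | (a, b) # S' \<Rightarrow>
               (case f of
                  Silence \<Rightarrow> (S', None)
                | Heard i \<Rightarrow> (S', Some i)
                | Collision \<Rightarrow> ((a, mid a b) # (Suc (mid a b), b) # S', None))))"

text \<open>
  One round \<open>t\<close>: transmission, feedback, injection, state change.  Packets injected in the last
  round of a phase belong to that phase, hence are old in the next one.
\<close>

definition step ::
  "nat \<Rightarrow> (nat \<Rightarrow> nat \<Rightarrow> nat) \<Rightarrow> (nat \<Rightarrow> nat \<Rightarrow> nat) \<Rightarrow> nat \<Rightarrow> config \<Rightarrow> config" where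
  "step n mid adv t c =
     (let q = (\<lambda>i. (case heard n c of None \<Rightarrow> queue c i | Some p \<Rightarrow> remove1 p (queue c i))
                     @ map (Packet t i) [0..<adv t i]);
          (S, h) = control_step mid (channel (transmitters n c)) (stack c) (holder c)
      in if S = [] \<and> h = None
         then \<lparr>queue = q, stack = [(0, n - 1)], holder = None,
               prev_start = cur_start c, cur_start = Suc t\<rparr>
         else c\<lparr>queue := q, stack := S, holder := h\<rparr>)"

primrec of_srr ::
  "nat \<Rightarrow> (nat \<Rightarrow> nat \<Rightarrow> nat) \<Rightarrow> (nat \<Rightarrow> nat \<Rightarrow> nat) \<Rightarrow> nat \<Rightarrow> config" where
  "of_srr n mid adv 0 =
     \<lparr>queue = (\<lambda>i. []), stack = [(0, n - 1)], holder = None, prev_start = 0, cur_start = 0\<rparr>"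
| "of_srr n mid adv (Suc t) = step n mid adv t (of_srr n mid adv t)"

text \<open>
  Total queue size at the beginning of round \<open>t\<close>.  Inside round \<open>t\<close> it only drops until the
  injection, after which it equals the value at the beginning of round \<open>Suc t\<close>.
\<close>

definition total_queued ::
  "nat \<Rightarrow> (nat \<Rightarrow> nat \<Rightarrow> nat) \<Rightarrow> (nat \<Rightarrow> nat \<Rightarrow> nat) \<Rightarrow> nat \<Rightarrow> nat" where
  "total_queued n mid adv t = (\<Sum>i<n. length (queue (of_srr n mid adv t) i))"

text \<open>
  Every injected packet is heard, and the rounds from its injection through its being heard,
  both included, number at most \<open>L\<close>.
\<close>

definition latency_at_most ::
  "nat \<Rightarrow> (nat \<Rightarrow> nat \<Rightarrow> nat) \<Rightarrow> (nat \<Rightarrow> nat \<Rightarrow> nat) \<Rightarrow> real \<Rightarrow> bool" where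
  "latency_at_most n mid adv L \<longleftrightarrow>
     (\<forall>p \<in> injected n adv. \<exists>r \<ge> born p.
        heard n (of_srr n mid adv r) = Some p \<and> real (card {born p..r}) \<le> L)"

end

theory Submission
  imports Defs
begin

text \<open>
  The remaining duration of a phase is bounded by a potential: every stacked interval
  contributes \<open>f m k\<close>, where \<open>m\<close> is its number of names and \<open>k\<close> the number of old packets in
  it, and a holder contributes its old packets plus one.  Both \<open>f m k = 2 m - 1 + k\<close> and
  \<open>f m k = 1 + k (1 + lg m)\<close> make the potential drop in every round.  So a phase of length
  \<open>L\<close> that follows one with \<open>J\<close> injections satisfies \<open>L \<le> 2 n - 1 + J\<close> and
  \<open>L \<le> 1 + J (1 + lg n)\<close>.

  The burst \<open>\<beta>\<close> enters the bounds only once because the adversary owns a token bucket: with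
  level \<open>\<sigma>\<close> at the start and \<open>\<sigma>'\<close> at the end of a phase with \<open>I\<close> injections,
  \<open>I + \<sigma>' \<le> \<rho> L + \<sigma>\<close>.  Induction over
  the phases yields \<open>L \<le> (2 n - 1) / (1 - \<rho>) + \<beta> - \<sigma>\<close>, and \<open>I + \<sigma>' \<le> \<beta> + \<rho>\<close>
  (hence \<open>I \<le> \<beta>\<close>) if \<open>\<rho> (2 + lg n) \<le> 1\<close>.
\<close>

section \<open>The adversary's budget as a bucket level\<close>

section \<open>Token bucket\<close>

text \<open>The constraint on all segments is condensed into one state value, so that burst
  allowance spent in one phase is visibly missing in the next.\<close>

primrec tokens :: "real \<Rightarrow> real \<Rightarrow> (nat \<Rightarrow> nat) \<Rightarrow> nat \<Rightarrow> real" where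
  "tokens \<rho> \<beta> a 0 = \<beta>"
| "tokens \<rho> \<beta> a (Suc t) = min \<beta> (tokens \<rho> \<beta> a t + \<rho> - real (a t))"

lemma tokens_le: "tokens \<rho> \<beta> a t \<le> \<beta>"
  by (cases t) auto

text \<open>The witness \<open>s\<close> is the last time the bucket was full; after it the cap
  never acts, so the level is the plain balance of refill and spending.\<close>

lemma tokens_attained:
  "\<exists>s\<le>t. tokens \<rho> \<beta> a t = \<beta> + \<rho> * real (t - s) - real (\<Sum>r\<in>{s..<t}. a r)"
proof (induction t)
  case 0
  show ?case by simp
next
  case (Suc t)
  then obtain s where s: "s \<le> t"
    "tokens \<rho> \<beta> a t = \<beta> + \<rho> * real (t - s) - real (\<Sum>r\<in>{s..<t}. a r)" by blast
  show ?case
  proof (cases "tokens \<rho> \<beta> a (Suc t) = \<beta>")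
    case True
    then show ?thesis by (intro exI[of _ "Suc t"]) simp
  next
    case False
    then have "tokens \<rho> \<beta> a (Suc t) = tokens \<rho> \<beta> a t + \<rho> - real (a t)"
      by (auto simp: min_def split: if_splits)
    with s show ?thesis
      by (intro exI[of _ s]) (auto simp: Suc_diff_le algebra_simps)
  qed
qed

text \<open>Without the cap the recurrence telescopes, and the cap can only lower the level.\<close>

lemma tokens_spend:
  "s \<le> t \<Longrightarrow>
   real (\<Sum>r\<in>{s..<t}. a r) + tokens \<rho> \<beta> a t \<le> \<rho> * real (t - s) + tokens \<rho> \<beta> a s"
proof (induction t rule: dec_induct)
  case base
  show ?case by simp
next
  case (step t)
  have "tokens \<rho> \<beta> a (Suc t) \<le> tokens \<rho> \<beta> a t + \<rho> - real (a t)" by simp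
  with step show ?case by (auto simp: Suc_diff_le algebra_simps)
qed

definition arrivals :: "nat \<Rightarrow> (nat \<Rightarrow> nat \<Rightarrow> nat) \<Rightarrow> nat \<Rightarrow> nat \<Rightarrow> nat" where
  "arrivals n adv s t = (\<Sum>r\<in>{s..<t}. \<Sum>i<n. adv r i)"

lemma arrivals_swap: "arrivals n adv s t = (\<Sum>i<n. \<Sum>r\<in>{s..<t}. adv r i)"
  unfolding arrivals_def by (rule sum.swap)

text \<open>The adversary's constraint on the segment since the bucket was last full says exactly
  that the balance is not negative.\<close>

lemma tokens_nonneg:
  assumes "leaky_bucket \<rho> \<beta> n adv" and "0 \<le> \<beta>"
  shows "0 \<le> tokens \<rho> \<beta> (\<lambda>r. \<Sum>i<n. adv r i) t"
proof -
  obtain s where s: "s \<le> t" "tokens \<rho> \<beta> (\<lambda>r. \<Sum>i<n. adv r i) t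
      = \<beta> + \<rho> * real (t - s) - real (\<Sum>r\<in>{s..<t}. \<Sum>i<n. adv r i)"
    using tokens_attained by blast
  show ?thesis
  \<comment> \<open>The constraint speaks of nonempty segments only; for \<open>s = t\<close> the
    level is \<open>\<beta>\<close> itself.\<close>
  proof (cases "s = t")
    case True
    with s assms show ?thesis by simp
  next
    case False
    with s have "t - s > 0" "s + (t - s) = t" by auto
    then have "real (\<Sum>r\<in>{s..<t}. \<Sum>i<n. adv r i) \<le> \<rho> * real (t - s) + \<beta>"
      using assms(1) unfolding leaky_bucket_def by metis
    with s show ?thesis by simp
  qed
qed

section \<open>Bounds on the time to search an interval\<close>

section \<open>Search costs\<close>

text \<open>The first condition pays for a silent probe, or for one station sending \<open>k\<close>
  packets and then falling silent. The strict inequality for balanced halves pays for the round of a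
  collision.\<close>

definition search_cost :: "(nat \<Rightarrow> nat \<Rightarrow> nat) \<Rightarrow> bool" where
  "search_cost f \<longleftrightarrow>
     (\<forall>m k. k < f m k) \<and> (\<forall>m. mono (f m)) \<and>
     (\<forall>x y k l. 0 < x \<and> 0 < y \<and> \<bar>int x - int y\<bar> \<le> 1 \<and> 2 \<le> k + l \<longrightarrow>
        f x k + f y l < f (x + y) (k + l))"

lemma search_cost_split:
  assumes "search_cost f" "0 < x" "0 < y" "\<bar>int x - int y\<bar> \<le> 1" "2 \<le> k + l"
  shows "f x k + f y l < f (x + y) (k + l)"
  using assms unfolding search_cost_def by blast

text \<open>A binary tree with \<open>m\<close> leaves has \<open>2 * m - 1\<close> nodes, one probe
  each. A station with packets adds one round per packet: those after its first packet and the
  closing silence. Truncated subtraction keeps the value above \<open>k\<close> at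
  \<open>m = 0\<close>.\<close>

definition linear_cost :: "nat \<Rightarrow> nat \<Rightarrow> nat" where
  "linear_cost m k = 2 * (m - 1) + 1 + k"

text \<open>A collision involves at least two packets, and a packet lies in at most
  \<open>lg m\<close> colliding intervals, so twice the number of collisions is at most
  \<open>k * lg m\<close>. That many probes plus one, and \<open>k\<close> further rounds as in the
  linear cost, give the formula.\<close>

definition log_cost :: "nat \<Rightarrow> nat \<Rightarrow> nat" where
  "log_cost m k = 1 + k * (1 + nat (lg (real m)))"

lemma search_cost_linear: "search_cost linear_cost"
  by (auto simp: search_cost_def linear_cost_def mono_def)

lemma lg_nonneg:
  assumes "1 \<le> x" shows "0 \<le> lg x"
proof -
  have "-1 < log 2 x" using assms zero_le_log_cancel_iff[of 2 x] by linarith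
  then show ?thesis by (simp add: lg_def le_ceiling_iff)
qed

text \<open>Balance makes \<open>x\<close> at most half of \<open>x + y\<close> rounded up, which is
  \<open>(x + y - 1) div 2 + 1\<close>, and this halving lowers the rounded-up logarithm by exactly
  one.\<close>

lemma lg_half:
  assumes "0 < x" "0 < y" "\<bar>int x - int y\<bar> \<le> 1"
  shows "Suc (nat (lg (real x))) \<le> nat (lg (real (x + y)))"
proof -
  have x: "x \<le> (x + y - 1) div 2 + 1" using assms by linarith
  have "lg (real (x + y)) = lg (real ((x + y - 1) div 2 + 1)) + 1"
    unfolding lg_def using ceiling_log2_div2[of "x + y"] assms by (simp add: add.commute)
  moreover have "lg (real x) \<le> lg (real ((x + y - 1) div 2 + 1))"
    unfolding lg_def using x assms by (intro ceiling_mono) (simp add: Transcendental.log_mono)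
  moreover have "0 \<le> lg (real x)" using assms by (intro lg_nonneg) simp
  ultimately show ?thesis by linarith
qed

lemma search_cost_log: "search_cost log_cost"
proof -
  have "log_cost x k + log_cost y l < log_cost (x + y) (k + l)"
    if h: "0 < x" "0 < y" "\<bar>int x - int y\<bar> \<le> 1" "2 \<le> k + l" for x y k l
  proof -
    let ?d = "nat (lg (real (x + y)))"
    have "Suc (nat (lg (real x))) \<le> ?d" using lg_half h by blast
    moreover have "Suc (nat (lg (real y))) \<le> ?d"
      using lg_half[of y x] h by (simp add: add.commute abs_minus_commute)
    ultimately have "k * Suc (nat (lg (real x))) \<le> k * ?d" "l * Suc (nat (lg (real y))) \<le> l * ?d"
      using mult_le_mono2 by blast+
    \<comment> \<open>Beyond \<open>(k + l) * ?d\<close> the left side has at most 2 and the right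
      side has \<open>1 + k + l\<close>, which is at least 3.\<close>
    with h(4) show ?thesis unfolding log_cost_def by (simp add: algebra_simps)
  qed
  moreover have "mono (log_cost m)" for m
    unfolding log_cost_def mono_def by (intro allI impI add_left_mono mult_right_mono) auto
  moreover have "k < log_cost m k" for m k
    by (simp add: log_cost_def)
  ultimately show ?thesis by (simp add: search_cost_def)
qed

section \<open>Remaining work in a phase\<close>

section \<open>Potential of a configuration\<close>

definition old_load :: "nat \<Rightarrow> config \<Rightarrow> nat set \<Rightarrow> nat" where
  "old_load n c A = (\<Sum>i\<in>A \<inter> {..<n}. length (old_queue c i))"

definition stack_cost :: "(nat \<Rightarrow> nat \<Rightarrow> nat) \<Rightarrow> nat \<Rightarrow> config \<Rightarrow> interval list \<Rightarrow> nat" where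
  "stack_cost f n c S = (\<Sum>(a, b)\<leftarrow>S. f (card {a..b}) (old_load n c {a..b}))"

definition potential :: "(nat \<Rightarrow> nat \<Rightarrow> nat) \<Rightarrow> nat \<Rightarrow> config \<Rightarrow> nat" where
  "potential f n c =
     stack_cost f n c (stack c)
     + (case holder c of None \<Rightarrow> 0 | Some j \<Rightarrow> 1 + length (old_queue c j))"

text \<open>Correctness of the search: no station with old packets is lost. When stack and holder
  are gone, it forces all old packets to have been sent.\<close>

definition covered :: "nat \<Rightarrow> config \<Rightarrow> bool" where
  "covered n c \<longleftrightarrow>
     (\<forall>i<n. old_queue c i \<noteq> [] \<longrightarrow> holder c = Some i \<or> i \<in> (\<Union>(a, b)\<in>set (stack c). {a..b}))"

lemma old_load_mono:
  "(\<And>i. length (old_queue c i) \<le> length (old_queue c' i)) \<Longrightarrow>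
   old_load n c A \<le> old_load n c' A"
  unfolding old_load_def by (intro sum_mono) auto

lemma old_load_ge:
  "i \<in> A \<Longrightarrow> i < n \<Longrightarrow> length (old_queue c i) \<le> old_load n c A"
  unfolding old_load_def by (rule member_le_sum) auto

lemma card_transmitters_le_old_load:
  assumes "transmitters n c \<subseteq> A"
  shows "card (transmitters n c) \<le> old_load n c A"
proof -
  have "card (transmitters n c) \<le> (\<Sum>i\<in>transmitters n c. length (old_queue c i))"
    using sum_mono[of "transmitters n c" "\<lambda>_. 1" "\<lambda>i. length (old_queue c i)"]
    by (auto simp: transmitters_def Suc_le_eq)
  also have "\<dots> \<le> old_load n c A"
    unfolding old_load_def using assms
    by (intro sum_mono2) (auto simp: transmitters_def)
  finally show ?thesis .
qed

lemma old_load_Un: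
  "A \<inter> B = {} \<Longrightarrow> old_load n c (A \<union> B) = old_load n c A + old_load n c B"
  unfolding old_load_def Int_Un_distrib2 by (rule sum.union_disjoint) auto

text \<open>An inequality is enough to sum over the stack, and it avoids tracking that stacked
  intervals are disjoint.\<close>

lemma old_load_subadd: "old_load n c (A \<union> B) \<le> old_load n c A + old_load n c B"
  unfolding old_load_def Int_Un_distrib2 by (subst sum.union_inter[symmetric]) auto

lemma stack_cost_mono:
  assumes "search_cost f" "\<And>i. length (old_queue c i) \<le> length (old_queue c' i)"
  shows "stack_cost f n c S \<le> stack_cost f n c' S"
  unfolding stack_cost_def using assms old_load_mono[OF assms(2)]
  by (intro sum_list_mono) (auto simp: search_cost_def mono_def)

lemma old_load_le_stack_cost:
  assumes "search_cost f"
  shows "old_load n c (\<Union>(a, b)\<in>set S. {a..b}) \<le> stack_cost f n c S"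
proof (induction S)
  case Nil
  show ?case by (simp add: old_load_def)
next
  case (Cons I S)
  obtain a b where I: "I = (a, b)" by (cases I)
  have "old_load n c {a..b} \<le> f (card {a..b}) (old_load n c {a..b})"
    using assms by (auto simp: search_cost_def less_imp_le)
  with Cons show ?case
    using old_load_subadd[of n c "{a..b}" "\<Union>(a, b)\<in>set S. {a..b}"]
    by (simp add: I stack_cost_def)
qed

text \<open>All old packets sit in stacked intervals or at the holder, and a search cost exceeds its
  load. This trades packets still waiting against rounds already elapsed.\<close>

lemma old_load_le_potential:
  assumes "search_cost f" and "covered n c"
  shows "old_load n c {..<n} \<le> potential f n c"
proof -
  let ?U = "\<Union>(a, b)\<in>set (stack c). {a..b}"
  have "old_load n c {..<n} = old_load n c (?U \<union> set_option (holder c))"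
    unfolding old_load_def using assms(2)
    by (intro sum.mono_neutral_right) (auto simp: covered_def)
  also have "\<dots> \<le> old_load n c ?U + old_load n c (set_option (holder c))"
    by (rule old_load_subadd)
  also have "old_load n c (set_option (holder c))
      \<le> (case holder c of None \<Rightarrow> 0 | Some j \<Rightarrow> 1 + length (old_queue c j))"
    by (cases "holder c") (simp_all add: old_load_def Int_insert_left)
  finally show ?thesis
    using old_load_le_stack_cost[OF assms(1), of n c "stack c"] unfolding potential_def by linarith
qed

section \<open>Effect of a round on potential and coverage\<close>

section \<open>One round\<close>

text \<open>A round without the change of phase that may end it.\<close>

definition advance ::
  "nat \<Rightarrow> (nat \<Rightarrow> nat \<Rightarrow> nat) \<Rightarrow> (nat \<Rightarrow> nat \<Rightarrow> nat) \<Rightarrow> nat \<Rightarrow> config \<Rightarrow> config" where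
  "advance n mid adv t c =
     (let ctl = control_step mid (channel (transmitters n c)) (stack c) (holder c)
      in c\<lparr>queue := (\<lambda>i. (case heard n c of None \<Rightarrow> queue c i | Some p \<Rightarrow> remove1 p (queue c i))
                        @ map (Packet t i) [0..<adv t i]),
           stack := fst ctl, holder := snd ctl\<rparr>)"

definition exhausted :: "config \<Rightarrow> bool" where
  "exhausted c \<longleftrightarrow> stack c = [] \<and> holder c = None"

lemma step_advance:
  "step n mid adv t c =
     (let c' = advance n mid adv t c
      in if exhausted c'
         then c'\<lparr>stack := [(0, n - 1)], prev_start := cur_start c, cur_start := Suc t\<rparr>
         else c')"
  by (simp add: step_def advance_def exhausted_def Let_def split: prod.split)

lemma advance_starts [simp]:
  "prev_start (advance n mid adv t c) = prev_start c"
  "cur_start (advance n mid adv t c) = cur_start c"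
  by (simp_all add: advance_def Let_def)

text \<open>Packets injected in round \<open>t\<close> are new because
  \<open>cur_start c \<le> t\<close>, and the phase boundaries stay fixed, so only a transmission
  affects the old packets.\<close>

lemma old_queue_advance:
  assumes "cur_start c \<le> t"
  shows "old_queue (advance n mid adv t c) i =
    (case heard n c of None \<Rightarrow> old_queue c i | Some p \<Rightarrow> remove1 p (old_queue c i))"
proof -
  have "old (advance n mid adv t c) = old c" by (simp add: fun_eq_iff old_def)
  then show ?thesis
    using assms
    by (auto simp: old_queue_def advance_def Let_def filter_map comp_def old_def filter_remove1
        split: option.split)
qed

lemma length_old_queue_advance_le:
  assumes "cur_start c \<le> t"
  shows "length (old_queue (advance n mid adv t c) i) \<le> length (old_queue c i)"
  by (auto simp: old_queue_advance[OF assms] length_remove1 split: option.split)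

lemma channel_Heard:
  assumes "channel (transmitters n c) = Heard i"
  shows "transmitters n c = {i}"
  using assms is_singleton_the_elem[of "transmitters n c"]
  by (simp add: channel_def is_singleton_altdef split: if_splits)

lemma channel_Silence: "channel T = Silence \<longleftrightarrow> T = {}"
  by (simp add: channel_def)

lemma length_old_queue_advance_heard:
  assumes "cur_start c \<le> t" and "channel (transmitters n c) = Heard i"
  shows "length (old_queue c i) = Suc (length (old_queue (advance n mid adv t c) i))"
proof -
  have "old_queue c i \<noteq> []"
    using channel_Heard[OF assms(2)] by (auto simp: transmitters_def)
  moreover have "heard n c = Some (hd (old_queue c i))" using assms(2) by (simp add: heard_def)
  ultimately show ?thesis
    by (auto simp: old_queue_advance[OF assms(1)] length_remove1 Suc_diff_1)
qed

lemma channel_Collision: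
  assumes "channel (transmitters n c) = Collision"
  shows "2 \<le> card (transmitters n c)"
proof -
  have "finite (transmitters n c)" by (simp add: transmitters_def)
  with assms have "card (transmitters n c) \<noteq> 0" "card (transmitters n c) \<noteq> 1"
    by (auto simp: channel_def split: if_splits)
  then show ?thesis by linarith
qed

lemma channel_held:
  assumes "holder c = Some j"
  shows "channel (transmitters n c) = Silence \<or> channel (transmitters n c) = Heard j"
proof -
  have "transmitters n c \<subseteq> {j}"
    using assms by (auto simp: transmitters_def may_transmit_def)
  then have "transmitters n c = {} \<or> transmitters n c = {j}" by (rule subset_singletonD)
  then show ?thesis by (elim disjE) (simp_all add: channel_def)
qed

lemma transmitters_interval:
  assumes "holder c = None" "stack c = (a, b) # S"
  shows "transmitters n c \<subseteq> {a..b}"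
  using assms by (auto simp: transmitters_def may_transmit_def)

lemma collision_interval:
  assumes "holder c = None" "stack c = (a, b) # S" "channel (transmitters n c) = Collision"
  shows "a < b"
proof -
  have "2 \<le> card {a..b}"
    using channel_Collision[OF assms(3)]
      card_mono[OF finite_atLeastAtMost transmitters_interval[OF assms(1,2)], of n] by linarith
  then show ?thesis by simp
qed

lemma halving_split:
  assumes "halving mid" "a < b"
  shows "{a..b} = {a..mid a b} \<union> {Suc (mid a b)..b}"
  using assms(1)[unfolded halving_def, rule_format, OF assms(2)] by auto

lemma potential_advance:
  assumes f: "search_cost f" and mid: "halving mid" and t: "cur_start c \<le> t"
    and ne: "\<not> exhausted c"
  shows "potential f n (advance n mid adv t c) < potential f n c"
proof -
  let ?c = "advance n mid adv t c" and ?f = "channel (transmitters n c)"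
  \<comment> \<open>No old queue grows, so the cost of a fixed list of intervals never rises; each
    case below only has to find one lost unit.\<close>
  have le: "stack_cost f n ?c S \<le> stack_cost f n c S" for S
    by (intro stack_cost_mono f length_old_queue_advance_le t)
  have ctl: "(stack ?c, holder ?c) = control_step mid ?f (stack c) (holder c)"
    by (simp add: advance_def Let_def)
  show ?thesis
  proof (cases "holder c")
    case (Some j)
    from channel_held[OF Some, of n] show ?thesis
    proof
      assume "?f = Silence"
      with ctl Some le[of "stack c"] show ?thesis
        by (simp add: control_step_def potential_def)
    next
      assume h: "?f = Heard j"
      with ctl Some le[of "stack c"] length_old_queue_advance_heard[OF t h, of mid adv]
      show ?thesis by (simp add: control_step_def potential_def)
    qed
  next
    case None
    with ne obtain a b S where S: "stack c = (a, b) # S"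
      unfolding exhausted_def by (metis neq_Nil_conv surj_pair)
    have pot: "potential f n c = f (card {a..b}) (old_load n c {a..b}) + stack_cost f n c S"
      using None S by (simp add: potential_def stack_cost_def)
    have gt: "old_load n c {a..b} < f (card {a..b}) (old_load n c {a..b})"
      using f by (simp add: search_cost_def)
    show ?thesis
    proof (cases ?f)
      case Silence
      with ctl None S le[of S] gt show ?thesis
        unfolding pot by (simp add: control_step_def potential_def)
    next
      case (Heard i)
      have "transmitters n c = {i}" by (rule channel_Heard[OF Heard])
      then have "i \<in> {a..b}" "i < n"
        using transmitters_interval[OF None S, of n] by (auto simp: transmitters_def)
      \<comment> \<open>The new holder's contribution, one plus its remaining old packets, equals
        its old packets before this transmission.\<close>
      then have "length (old_queue c i) \<le> old_load n c {a..b}" by (rule old_load_ge)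
      with ctl None S Heard le[of S] gt length_old_queue_advance_heard[OF t Heard, of mid adv]
      show ?thesis unfolding pot by (simp add: control_step_def potential_def)
    next
      case Collision
      let ?m = "mid a b"
      have ab: "a < b" by (rule collision_interval[OF None S Collision])
      have split: "{a..b} = {a..?m} \<union> {Suc ?m..b}" by (rule halving_split[OF mid ab])
      have loads: "old_load n c {a..b} = old_load n c {a..?m} + old_load n c {Suc ?m..b}"
        unfolding split by (rule old_load_Un) auto
      have cards: "card {a..b} = card {a..?m} + card {Suc ?m..b}"
        unfolding split by (rule card_Un_disjoint) auto
      have "2 \<le> old_load n c {a..b}"
        using channel_Collision[OF Collision]
          card_transmitters_le_old_load[OF transmitters_interval[OF None S], of n] by linarith
      moreover have "0 < card {a..?m}" "0 < card {Suc ?m..b}"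
        "\<bar>int (card {a..?m}) - int (card {Suc ?m..b})\<bar> \<le> 1"
        using mid[unfolded halving_def, rule_format, OF ab] by (simp_all del: card_atLeastAtMost) auto
      ultimately have "stack_cost f n c [(a, ?m), (Suc ?m, b)]
          < f (card {a..b}) (old_load n c {a..b})"
        using search_cost_split[OF f] unfolding loads cards stack_cost_def
        by (simp del: card_atLeastAtMost)
      moreover have "potential f n ?c = stack_cost f n ?c [(a, ?m), (Suc ?m, b)] + stack_cost f n ?c S"
        using ctl None S Collision by (simp add: control_step_def potential_def stack_cost_def)
      ultimately show ?thesis
        unfolding pot using le[of S] le[of "[(a, ?m), (Suc ?m, b)]"] by linarith
    qed
  qed
qed

text \<open>Silence shows that nothing old is in the removed interval or at the released holder, a
  lone transmitter becomes holder, and after a collision the two halves cover the interval.\<close>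

lemma covered_advance:
  assumes cov: "covered n c" and mid: "halving mid" and t: "cur_start c \<le> t"
    and ne: "\<not> exhausted c"
  shows "covered n (advance n mid adv t c)"
proof -
  let ?c = "advance n mid adv t c" and ?f = "channel (transmitters n c)"
  have ctl: "(stack ?c, holder ?c) = control_step mid ?f (stack c) (holder c)"
    by (simp add: advance_def Let_def)
  have "holder ?c = Some i \<or> i \<in> (\<Union>(a, b)\<in>set (stack ?c). {a..b})"
    if i: "i < n" "old_queue ?c i \<noteq> []" for i
  proof -
    have old: "old_queue c i \<noteq> []"
      using i length_old_queue_advance_le[OF t, of n mid adv i] by auto
    then have old_cov: "holder c = Some i \<or> i \<in> (\<Union>(a, b)\<in>set (stack c). {a..b})"
      using cov i by (simp add: covered_def)
    show ?thesis
    proof (cases "holder c")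
      case (Some j)
      have "i \<noteq> j" if "?f = Silence"
        using that old i Some by (auto simp: channel_Silence transmitters_def may_transmit_def)
      with channel_held[OF Some, of n] ctl Some old_cov show ?thesis
        by (auto simp: control_step_def)
    next
      case None
      with ne obtain a b S where S: "stack c = (a, b) # S"
        unfolding exhausted_def by (metis neq_Nil_conv surj_pair)
      have tr: "i \<in> transmitters n c" if "i \<in> {a..b}"
        using that old i None S by (auto simp: transmitters_def may_transmit_def)
      show ?thesis
      proof (cases ?f)
        case Silence
        with tr have "i \<notin> {a..b}" by (auto simp: channel_Silence)
        with Silence ctl None S old_cov show ?thesis by (auto simp: control_step_def)
      next
        case (Heard j)
        with tr have "i = j" if "i \<in> {a..b}"
          using channel_Heard[OF Heard] that by auto
        with Heard ctl None S old_cov show ?thesis by (auto simp: control_step_def)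
      next
        case Collision
        have "{a..b} = {a..mid a b} \<union> {Suc (mid a b)..b}"
          by (rule halving_split[OF mid collision_interval[OF None S Collision]])
        with Collision ctl None S old_cov show ?thesis by (auto simp: control_step_def)
      qed
    qed
  qed
  then show ?thesis unfolding covered_def by blast
qed

lemma queue_advance_subset:
  "set (queue (advance n mid adv t c) i) \<subseteq> set (queue c i) \<union> {p. born p = t}"
  by (auto simp: advance_def Let_def dest: subsetD[OF set_remove1_subset] split: option.splits)

lemma queue_advance_removed:
  assumes "p \<in> set (queue c i)" "p \<notin> set (queue (advance n mid adv t c) i)"
  shows "heard n c = Some p"
  using assms by (auto simp: advance_def Let_def split: option.splits)

lemma new_queue_advance_le:
  assumes "cur_start c \<le> t"
    and "length (filter (\<lambda>p. cur_start c \<le> born p) (queue c i)) \<le> (\<Sum>r\<in>{cur_start c..<t}. adv r i)"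
  shows "length (filter (\<lambda>p. cur_start c \<le> born p) (queue (advance n mid adv t c) i))
    \<le> (\<Sum>r\<in>{cur_start c..<Suc t}. adv r i)"
proof -
  have "length (filter (\<lambda>p. cur_start c \<le> born p) (remove1 p xs))
      \<le> length (filter (\<lambda>p. cur_start c \<le> born p) xs)" for p xs
    by (simp add: filter_remove1 length_remove1)
  from this[of "the (heard n c)" "queue c i"] assms show ?thesis
    by (cases "heard n c") (simp_all add: advance_def Let_def filter_map comp_def)
qed

section \<open>Invariant, termination and induction over phases\<close>

section \<open>Phases\<close>

text \<open>The bound on new packets is there to become the bound on old ones at the next change of
  phase. The last clause says that potential plus elapsed time stays within the initial cost;
  quantifying over \<open>f\<close> serves both costs at once.\<close>

definition phase_invariant :: "nat \<Rightarrow> (nat \<Rightarrow> nat \<Rightarrow> nat) \<Rightarrow> nat \<Rightarrow> config \<Rightarrow> bool" where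
  "phase_invariant n adv t c \<longleftrightarrow>
     \<not> exhausted c \<and> covered n c \<and> prev_start c \<le> cur_start c \<and> cur_start c \<le> t \<and>
     (\<forall>i<n. \<forall>p\<in>set (queue c i). prev_start c \<le> born p \<and> born p < t) \<and>
     (\<forall>i<n. length (filter (\<lambda>p. cur_start c \<le> born p) (queue c i))
        \<le> (\<Sum>r\<in>{cur_start c..<t}. adv r i)) \<and>
     (\<forall>i<n. length (old_queue c i) \<le> (\<Sum>r\<in>{prev_start c..<cur_start c}. adv r i)) \<and>
     (\<forall>f. search_cost f \<longrightarrow>
        potential f n c + (t - cur_start c) \<le> f n (arrivals n adv (prev_start c) (cur_start c)))"

lemma exhausted_queue:
  assumes "covered n c" "exhausted c" "i < n"
    and "\<And>p. p \<in> set (queue c i) \<Longrightarrow> prev_start c \<le> born p"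
  shows "\<forall>p\<in>set (queue c i). cur_start c \<le> born p"
proof -
  have "old_queue c i = []"
    using assms(1-3) by (auto simp: covered_def exhausted_def)
  with assms(4) show ?thesis
    by (force simp: old_queue_def old_def filter_empty_conv)
qed

lemma phase_invariant_init:
  assumes "1 \<le> n"
  shows "phase_invariant n adv 0 (of_srr n mid adv 0)"
proof -
  have "{0..n - 1} = {..<n}" using assms by auto
  then show ?thesis
    using assms
    by (auto simp: phase_invariant_def exhausted_def covered_def potential_def stack_cost_def
        old_load_def old_queue_def arrivals_def)
qed

text \<open>The clauses at clock \<open>Suc t\<close>, before a possible change of phase. The last
  one therefore also bounds the full length of a phase that ends in round \<open>t\<close>.\<close>

lemma phase_invariant_advance:
  assumes inv: "phase_invariant n adv t c" and mid: "halving mid"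
  defines "c' \<equiv> advance n mid adv t c"
  shows "covered n c'"
    and "\<And>i p. i < n \<Longrightarrow> p \<in> set (queue c' i) \<Longrightarrow> prev_start c \<le> born p \<and> born p < Suc t"
    and "\<And>i. i < n \<Longrightarrow> length (filter (\<lambda>p. cur_start c \<le> born p) (queue c' i))
        \<le> (\<Sum>r\<in>{cur_start c..<Suc t}. adv r i)"
    and "\<And>i. i < n \<Longrightarrow> length (old_queue c' i) \<le> (\<Sum>r\<in>{prev_start c..<cur_start c}. adv r i)"
    and "\<And>f. search_cost f \<Longrightarrow>
        potential f n c' + (Suc t - cur_start c)
          \<le> f n (arrivals n adv (prev_start c) (cur_start c))"
proof -
  have t: "cur_start c \<le> t" and ne: "\<not> exhausted c"
    using inv by (auto simp: phase_invariant_def)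
  show "covered n c'"
    using inv covered_advance mid t ne unfolding c'_def phase_invariant_def by blast
  show "prev_start c \<le> born p \<and> born p < Suc t" if "i < n" "p \<in> set (queue c' i)" for i p
  proof -
    from that(2) have "p \<in> set (queue c i) \<or> born p = t"
      using queue_advance_subset unfolding c'_def by blast
    then show ?thesis using inv that(1) by (force simp: phase_invariant_def)
  qed
  show "length (filter (\<lambda>p. cur_start c \<le> born p) (queue c' i))
        \<le> (\<Sum>r\<in>{cur_start c..<Suc t}. adv r i)" if "i < n" for i
    using inv that new_queue_advance_le[OF t] unfolding c'_def phase_invariant_def by blast
  show "length (old_queue c' i) \<le> (\<Sum>r\<in>{prev_start c..<cur_start c}. adv r i)" if "i < n" for i
    using inv that length_old_queue_advance_le[OF t] order_trans
    unfolding c'_def phase_invariant_def by blast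
  show "potential f n c' + (Suc t - cur_start c)
          \<le> f n (arrivals n adv (prev_start c) (cur_start c))" if f: "search_cost f" for f
  proof -
    have "potential f n c + (t - cur_start c) \<le> f n (arrivals n adv (prev_start c) (cur_start c))"
      using inv f unfolding phase_invariant_def by blast
    with potential_advance[OF f mid t ne, of n adv] t show ?thesis unfolding c'_def by linarith
  qed
qed

lemma phase_invariant_step:
  assumes inv: "phase_invariant n adv t c" and mid: "halving mid" and n: "1 \<le> n"
  shows "phase_invariant n adv (Suc t) (step n mid adv t c)"
proof -
  let ?c = "advance n mid adv t c"
  note adv = phase_invariant_advance[OF inv mid]
  have t: "prev_start c \<le> cur_start c" "cur_start c \<le> t"
    using inv by (auto simp: phase_invariant_def)
  show ?thesis
  proof (cases "exhausted ?c")
    case False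
    with adv t show ?thesis
      by (simp add: step_advance phase_invariant_def)
  next
    case True
    let ?d = "?c\<lparr>stack := [(0, n - 1)], prev_start := cur_start c, cur_start := Suc t\<rparr>"
    have d: "step n mid adv t c = ?d" using True by (simp add: step_advance)
    \<comment> \<open>The finished phase has sent all its old packets, so everything still queued
      was injected during it and is now old.\<close>
    have q: "cur_start c \<le> born p \<and> born p < Suc t" if "i < n" "p \<in> set (queue ?c i)" for i p
      using exhausted_queue[OF adv(1) True] that adv(2) by auto
    have full: "{0..n - 1} = {..<n}" using n by auto
    have old: "length (old_queue ?d i) \<le> (\<Sum>r\<in>{cur_start c..<Suc t}. adv r i)" if "i < n" for i
    proof -
      have "old_queue ?d i = filter (\<lambda>p. cur_start c \<le> born p) (queue ?c i)"
        unfolding old_queue_def using q[OF that] by (intro filter_cong) (auto simp: old_def)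
      with adv(3)[OF that] show ?thesis by simp
    qed
    then have "old_load n ?d {..<n} \<le> arrivals n adv (cur_start c) (Suc t)"
      unfolding arrivals_swap old_load_def by (auto intro: sum_mono)
    moreover have "potential f n ?d = f n (old_load n ?d {..<n})" for f
      using True unfolding potential_def stack_cost_def exhausted_def
      by (simp add: full del: card_atLeastAtMost One_nat_def)
    ultimately have "potential f n ?d \<le> f n (arrivals n adv (cur_start c) (Suc t))"
      if "search_cost f" for f
      using that unfolding search_cost_def mono_def by metis
    moreover have "filter (\<lambda>p. Suc t \<le> born p) (queue ?c i) = []" if "i < n" for i
      using q[OF that] by (fastforce simp: filter_empty_conv)
    moreover have "covered n ?d"
      unfolding covered_def using n by (auto simp: less_eq_Suc_le)
    ultimately show ?thesis
      unfolding d phase_invariant_def using q t old by (auto simp: exhausted_def)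
  qed
qed

lemma phase_invariant_of_srr:
  assumes "halving mid" "1 \<le> n"
  shows "phase_invariant n adv t (of_srr n mid adv t)"
proof (induction t)
  case 0
  show ?case by (rule phase_invariant_init[OF assms(2)])
next
  case (Suc t)
  from phase_invariant_step[OF this assms] show ?case by simp
qed

text \<open>The potential drops in every round that does not end the phase, so some round
  \<open>e\<close> does.\<close>

lemma phase_end:
  assumes "halving mid" "1 \<le> n"
  shows "\<exists>e\<ge>t. prev_start (of_srr n mid adv (Suc e)) = cur_start (of_srr n mid adv t)
    \<and> cur_start (of_srr n mid adv (Suc e)) = Suc e
    \<and> (\<forall>f. search_cost f \<longrightarrow> Suc e - cur_start (of_srr n mid adv t)
        \<le> f n (arrivals n adv (prev_start (of_srr n mid adv t)) (cur_start (of_srr n mid adv t))))"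
proof (induction "potential linear_cost n (of_srr n mid adv t)" arbitrary: t rule: less_induct)
  case less
  let ?c = "of_srr n mid adv t"
  have inv: "phase_invariant n adv t ?c" by (rule phase_invariant_of_srr[OF assms])
  show ?case
  proof (cases "exhausted (advance n mid adv t ?c)")
    case True
    have "Suc t - cur_start ?c \<le> f n (arrivals n adv (prev_start ?c) (cur_start ?c))"
      if "search_cost f" for f
      using phase_invariant_advance(5)[OF inv assms(1) that] by linarith
    with True show ?thesis by (intro exI[of _ t]) (simp add: step_advance)
  next
    case False
    then have c: "of_srr n mid adv (Suc t) = advance n mid adv t ?c"
      by (simp add: step_advance)
    have "potential linear_cost n (of_srr n mid adv (Suc t)) < potential linear_cost n ?c"
      unfolding c using inv
      by (intro potential_advance search_cost_linear assms(1)) (simp_all add: phase_invariant_def)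
    from less[OF this] show ?thesis
      unfolding c advance_starts using Suc_leD by blast
  qed
qed

text \<open>Reduces a claim about consecutive phase boundaries to arithmetic on arrivals, free of
  configurations.\<close>

lemma phase_induct [consumes 2, case_names init step]:
  assumes "halving mid" "1 \<le> n"
    and init: "X 0 0"
    and step: "\<And>P Q R. X P Q \<Longrightarrow> P \<le> Q \<Longrightarrow> Q < R \<Longrightarrow>
      (\<And>f. search_cost f \<Longrightarrow> R - Q \<le> f n (arrivals n adv P Q)) \<Longrightarrow> X Q R"
  shows "X (prev_start (of_srr n mid adv t)) (cur_start (of_srr n mid adv t))"
proof (induction t)
  case 0
  show ?case by (simp add: init)
next
  case (Suc t)
  let ?c = "of_srr n mid adv t"
  have inv: "phase_invariant n adv t ?c" by (rule phase_invariant_of_srr[OF assms(1,2)])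
  have "Suc t - cur_start ?c \<le> f n (arrivals n adv (prev_start ?c) (cur_start ?c))"
    if "search_cost f" for f
    using phase_invariant_advance(5)[OF inv assms(1) that] by linarith
  moreover have "prev_start ?c \<le> cur_start ?c" "cur_start ?c < Suc t"
    using inv by (auto simp: phase_invariant_def)
  \<comment> \<open>The time bound holds at every round of the phase, so this is available whether
    or not the phase ends here.\<close>
  ultimately have "X (cur_start ?c) (Suc t)" using Suc step by blast
  with Suc show ?case by (simp add: step_advance Let_def)
qed

section \<open>Delivery of packets\<close>

lemma heard_if_dequeued:
  assumes "p \<in> set (queue (of_srr n mid adv s) i)" "s \<le> e"
    and "p \<notin> set (queue (of_srr n mid adv e) i)"
  shows "\<exists>r. s \<le> r \<and> r < e \<and> heard n (of_srr n mid adv r) = Some p"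
  using assms(2,1,3)
proof (induction e rule: dec_induct)
  case base
  then show ?case by simp
next
  case (step e)
  show ?case
  proof (cases "p \<in> set (queue (of_srr n mid adv e) i)")
    case True
    with step.prems have "p \<notin> set (queue (advance n mid adv e (of_srr n mid adv e)) i)"
      by (simp add: step_advance Let_def split: if_splits)
    with True step.hyps show ?thesis using queue_advance_removed by blast
  next
    case False
    with step show ?thesis using less_SucI by blast
  qed
qed

lemma injected_enqueued:
  assumes "p \<in> injected n adv"
  shows "p \<in> set (queue (of_srr n mid adv (Suc (born p))) (home p))"
proof -
  have "p \<in> Packet (born p) (home p) ` {0..<adv (born p) (home p)}"
    using assms by (cases p) (auto simp: injected_def)
  then show ?thesis by (simp add: step_advance advance_def Let_def)
qed

text \<open>Here \<open>t\<close> lies in the phase in which \<open>p\<close> is heard, and \<open>R\<close> is the first round after it.\<close>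

lemma packet_heard:
  assumes mid: "halving mid" and n: "1 \<le> n" and p: "p \<in> injected n adv"
  obtains r t R where "born p \<le> r" "heard n (of_srr n mid adv r) = Some p"
    "card {born p..r} \<le> R - prev_start (of_srr n mid adv t)"
    "\<And>f. search_cost f \<Longrightarrow> R - cur_start (of_srr n mid adv t)
        \<le> f n (arrivals n adv (prev_start (of_srr n mid adv t)) (cur_start (of_srr n mid adv t)))"
proof -
  let ?c = "of_srr n mid adv" and ?b = "born p"
  \<comment> \<open>\<open>e\<close> ends the phase of injection and \<open>e'\<close> the following
    one, in which the packet is old.\<close>
  obtain e where e: "e \<ge> ?b" "prev_start (?c (Suc e)) = cur_start (?c ?b)"
    "cur_start (?c (Suc e)) = Suc e"
    using phase_end[OF mid n] by blast
  obtain e' where e': "e' \<ge> Suc e" "prev_start (?c (Suc e')) = cur_start (?c (Suc e))"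
    "\<And>f. search_cost f \<Longrightarrow> Suc e' - cur_start (?c (Suc e))
        \<le> f n (arrivals n adv (prev_start (?c (Suc e))) (cur_start (?c (Suc e))))"
    using phase_end[OF mid n] by blast
  have "home p < n" using p by (simp add: injected_def)
  \<comment> \<open>After round \<open>e'\<close> the packet predates the previous phase, and by the
    invariant no such packet is queued.\<close>
  moreover have "?b < prev_start (?c (Suc e'))" using e(1,3) e'(2) by linarith
  ultimately have gone: "p \<notin> set (queue (?c (Suc e')) (home p))"
    using phase_invariant_of_srr[OF mid n, of adv "Suc e'"] leD
    unfolding phase_invariant_def by blast
  have "Suc ?b \<le> Suc e'" using e(1) e'(1) by linarith
  from heard_if_dequeued[OF injected_enqueued[OF p] this gone]
  obtain r where r: "Suc ?b \<le> r" "r < Suc e'" "heard n (?c r) = Some p" by blast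
  have "cur_start (?c ?b) \<le> ?b"
    using phase_invariant_of_srr[OF mid n, of adv ?b] by (simp add: phase_invariant_def)
  then have "card {?b..r} \<le> Suc e' - prev_start (?c (Suc e))"
    using r(2) unfolding e(2) by simp
  moreover have "?b \<le> r" using r(1) by simp
  ultimately show thesis using that r(3) e'(3) by blast
qed

section \<open>Queue contents in terms of arrivals\<close>

lemma total_queued_le:
  fixes adv
  assumes mid: "halving mid" and n: "1 \<le> n"
  defines "c \<equiv> of_srr n mid adv"
  shows "total_queued n mid adv t
    \<le> old_load n (c t) {..<n} + arrivals n adv (cur_start (c t)) t"
proof -
  have inv: "phase_invariant n adv t (c t)"
    unfolding c_def by (rule phase_invariant_of_srr[OF mid n])
  have "length (queue (c t) i)
      \<le> length (old_queue (c t) i) + (\<Sum>r\<in>{cur_start (c t)..<t}. adv r i)" if "i < n" for i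
  proof -
    have "\<forall>p\<in>set (queue (c t) i). prev_start (c t) \<le> born p"
      and new: "length (filter (\<lambda>p. cur_start (c t) \<le> born p) (queue (c t) i))
        \<le> (\<Sum>r\<in>{cur_start (c t)..<t}. adv r i)"
      using inv that unfolding phase_invariant_def by blast+
    \<comment> \<open>No queued packet is older than the previous phase, so one that is not old is
      new.\<close>
    then have "filter (\<lambda>p. \<not> old (c t) p) (queue (c t) i)
        = filter (\<lambda>p. cur_start (c t) \<le> born p) (queue (c t) i)"
      by (intro filter_cong) (auto simp: old_def)
    with new have "length (filter (\<lambda>p. \<not> old (c t) p) (queue (c t) i))
        \<le> (\<Sum>r\<in>{cur_start (c t)..<t}. adv r i)" by (simp only:)
    then show ?thesis
      using sum_length_filter_compl[of "old (c t)" "queue (c t) i"]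
      unfolding old_queue_def by linarith
  qed
  then have "total_queued n mid adv t
      \<le> (\<Sum>i<n. length (old_queue (c t) i) + (\<Sum>r\<in>{cur_start (c t)..<t}. adv r i))"
    unfolding total_queued_def c_def by (intro sum_mono) auto
  then show ?thesis by (simp add: sum.distrib old_load_def arrivals_swap)
qed

lemma old_load_le:
  fixes adv
  assumes mid: "halving mid" and n: "1 \<le> n"
  defines "c \<equiv> of_srr n mid adv"
  shows "old_load n (c t) {..<n} \<le> arrivals n adv (prev_start (c t)) (cur_start (c t))"
    and "search_cost f \<Longrightarrow> old_load n (c t) {..<n} + (t - cur_start (c t))
      \<le> f n (arrivals n adv (prev_start (c t)) (cur_start (c t)))"
proof -
  have inv: "phase_invariant n adv t (c t)"
    unfolding c_def by (rule phase_invariant_of_srr[OF mid n])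
  then show "old_load n (c t) {..<n} \<le> arrivals n adv (prev_start (c t)) (cur_start (c t))"
    unfolding old_load_def arrivals_swap phase_invariant_def by (auto intro: sum_mono)
  show "old_load n (c t) {..<n} + (t - cur_start (c t))
      \<le> f n (arrivals n adv (prev_start (c t)) (cur_start (c t)))" if f: "search_cost f"
  proof -
    have "potential f n (c t) + (t - cur_start (c t)) \<le> f n (arrivals n adv (prev_start (c t)) (cur_start (c t)))"
      and "covered n (c t)"
      using inv f unfolding phase_invariant_def by blast+
    then show ?thesis using old_load_le_potential[OF f, of n "c t"] by linarith
  qed
qed

section \<open>Bounds for every rate below one\<close>

section \<open>Bounds\<close>

context
  fixes n :: nat and \<rho> \<beta> :: real and mid adv :: "nat \<Rightarrow> nat \<Rightarrow> nat"
  assumes n: "1 \<le> n" and \<rho>: "0 < \<rho>" "\<rho> < 1" and \<beta>: "1 \<le> \<beta>"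
    and mid: "halving mid" and bucket: "leaky_bucket \<rho> \<beta> n adv"
begin

private abbreviation "\<sigma> \<equiv> tokens \<rho> \<beta> (\<lambda>r. \<Sum>i<n. adv r i)"
private abbreviation "c \<equiv> of_srr n mid adv"
private abbreviation "old_arrivals t \<equiv> arrivals n adv (prev_start (c t)) (cur_start (c t))"
text \<open>The fixed point of \<open>x = 2 * n - 1 + \<rho> * x\<close>, the phase length that
  reproduces itself at rate \<open>\<rho>\<close> without bursts.\<close>

private definition W :: real where "W = (2 * real n - 1) / (1 - \<rho>)"

private lemma arrivals_tokens:
  "s \<le> t \<Longrightarrow> real (arrivals n adv s t) + \<sigma> t \<le> \<rho> * real (t - s) + \<sigma> s"
  unfolding arrivals_def by (rule tokens_spend)

private lemma \<sigma>_bounds: "0 \<le> \<sigma> t" "\<sigma> t \<le> \<beta>"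
  using tokens_nonneg[OF bucket] \<beta> tokens_le by auto

private lemma W: "W = 2 * real n - 1 + \<rho> * W"
  using \<rho> by (simp add: W_def field_simps)

private lemma W_nonneg: "0 \<le> W"
  using \<rho> n by (simp add: W_def)

private lemma W_le: "2 * W \<le> 4 / (1 - \<rho>) * real n"
proof -
  have "2 * W = (4 * real n - 2) / (1 - \<rho>)"
    by (simp add: W_def algebra_simps flip: add_divide_distrib diff_divide_distrib)
  also have "\<dots> \<le> 4 * real n / (1 - \<rho>)" using \<rho> by (intro divide_right_mono) auto
  finally show ?thesis by simp
qed

private lemma starts: "prev_start (c t) \<le> cur_start (c t)" "cur_start (c t) \<le> t"
  using phase_invariant_of_srr[OF mid n, of adv t] by (auto simp: phase_invariant_def)

private lemma phase_length:
  "real (cur_start (c t) - prev_start (c t)) \<le> W + \<beta> - \<sigma> (prev_start (c t))"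
  using mid n
proof (induction t rule: phase_induct)
  case init
  show ?case using W_nonneg by simp
next
  case (step P Q R)
  have "R - Q \<le> linear_cost n (arrivals n adv P Q)"
    using step(4) search_cost_linear by blast
  then have "real (R - Q) \<le> 2 * real n - 1 + real (arrivals n adv P Q)"
    using n by (simp add: linear_cost_def)
  moreover have "\<rho> * real (Q - P) \<le> \<rho> * (W + \<beta> - \<sigma> P)"
    using step(1) \<rho> by (intro mult_left_mono) auto
  \<comment> \<open>The level \<open>\<sigma> P\<close> enters the arrivals with total coefficient
    \<open>1 - \<rho>\<close>; replacing it by \<open>\<beta>\<close> turns
    \<open>\<rho> * \<beta>\<close> into \<open>\<beta>\<close> and closes the induction.\<close>
  moreover have "0 \<le> (1 - \<rho>) * (\<beta> - \<sigma> P)"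
    using \<rho> \<sigma>_bounds[of P] by simp
  ultimately show ?case
    using arrivals_tokens[OF step(2)] W by (simp add: algebra_simps)
qed

private lemma old_arrivals_le:
  "real (old_arrivals t) + \<sigma> (cur_start (c t)) \<le> \<rho> * W + \<beta>"
proof -
  let ?P = "prev_start (c t)" and ?Q = "cur_start (c t)"
  have "\<rho> * real (?Q - ?P) \<le> \<rho> * (W + \<beta> - \<sigma> ?P)"
    using phase_length[of t] \<rho> by (intro mult_left_mono) auto
  moreover have "0 \<le> (1 - \<rho>) * (\<beta> - \<sigma> ?P)"
    using \<rho> \<sigma>_bounds[of ?P] by simp
  ultimately show ?thesis
    using arrivals_tokens[OF starts(1), of t] by (simp add: algebra_simps)
qed

lemma total_queued_bound:
  "real (total_queued n mid adv t) \<le> 4 * \<rho> / (1 - \<rho>) * real n + \<beta>"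
proof -
  let ?Q = "cur_start (c t)" and ?s = "real (t - cur_start (c t))"
  let ?old = "real (old_load n (c t) {..<n})" and ?N = "2 * real n - 1"
  have "real (total_queued n mid adv t) \<le> ?old + real (arrivals n adv ?Q t)"
    using total_queued_le[OF mid n, of adv t] by simp
  moreover have "real (arrivals n adv ?Q t) \<le> \<rho> * ?s + \<sigma> ?Q"
    using arrivals_tokens[OF starts(2), of t] \<sigma>_bounds(1)[of t] by linarith
  moreover have "?old \<le> real (old_arrivals t)"
    using old_load_le(1)[OF mid n] by simp
  moreover have "?old + ?s \<le> ?N + real (old_arrivals t)"
    using old_load_le(2)[OF mid n search_cost_linear, of adv t] n by (simp add: linear_cost_def)
  \<comment> \<open>A convex combination, with weights \<open>\<rho>\<close> and
    \<open>1 - \<rho>\<close>, of the two preceding bounds on the old packets.\<close>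
  moreover have "?old + \<rho> * ?s \<le> \<rho> * ?N + real (old_arrivals t)"
  proof -
    have "\<rho> * (?old + ?s) \<le> \<rho> * (?N + real (old_arrivals t))"
      and "(1 - \<rho>) * ?old \<le> (1 - \<rho>) * real (old_arrivals t)"
      using calculation(3,4) \<rho> by (auto intro: mult_left_mono)
    then show ?thesis by (simp add: algebra_simps)
  qed
  moreover have "\<rho> * ?N + \<rho> * W \<le> 4 * \<rho> / (1 - \<rho>) * real n"
  proof -
    have "0 \<le> \<rho> * W" using \<rho> W_nonneg by simp
    then have "\<rho> * ?N \<le> \<rho> * W" using W \<rho> by (intro mult_left_mono) auto
    moreover have "\<rho> * (2 * W) \<le> \<rho> * (4 / (1 - \<rho>) * real n)"
      using W_le \<rho> by (intro mult_left_mono) auto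
    ultimately show ?thesis by (simp add: algebra_simps)
  qed
  ultimately show ?thesis using old_arrivals_le[of t] by linarith
qed

text \<open>A packet waits at most through its phase of injection and the next phase, which ends
  just before round \<open>R\<close>.\<close>

private lemma latency_if_two_phases:
  assumes "\<And>t R. \<forall>f. search_cost f \<longrightarrow> R - cur_start (c t) \<le> f n (old_arrivals t) \<Longrightarrow>
    real (R - cur_start (c t)) + real (cur_start (c t) - prev_start (c t)) \<le> L"
  shows "latency_at_most n mid adv L"
  unfolding latency_at_most_def
proof
  fix p assume p: "p \<in> injected n adv"
  obtain r t R where r: "born p \<le> r" "heard n (c r) = Some p"
    "card {born p..r} \<le> R - prev_start (c t)"
    and R: "\<forall>f. search_cost f \<longrightarrow> R - cur_start (c t) \<le> f n (old_arrivals t)"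
    using packet_heard[OF mid n p] by metis
  have "R - prev_start (c t) \<le> (R - cur_start (c t)) + (cur_start (c t) - prev_start (c t))"
    by linarith
  then have "real (card {born p..r}) \<le> L"
    using r(3) assms[OF R] by linarith
  with r(1,2) show "\<exists>r\<ge>born p. heard n (c r) = Some p \<and> real (card {born p..r}) \<le> L" by blast
qed

lemma latency_bound: "latency_at_most n mid adv (4 / (1 - \<rho>) * real n + \<beta> * (1 + \<rho>))"
proof (rule latency_if_two_phases)
  fix t R
  let ?P = "prev_start (c t)" and ?Q = "cur_start (c t)"
  assume "\<forall>f. search_cost f \<longrightarrow> R - ?Q \<le> f n (old_arrivals t)"
  then have "R - ?Q \<le> linear_cost n (old_arrivals t)" using search_cost_linear by blast
  then have "real (R - ?Q) \<le> 2 * real n - 1 + real (old_arrivals t)"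
    using n by (simp add: linear_cost_def)
  moreover have "(1 + \<rho>) * real (?Q - ?P) \<le> (1 + \<rho>) * (W + \<beta> - \<sigma> ?P)"
    using phase_length[of t] \<rho> by (intro mult_left_mono) auto
  \<comment> \<open>\<open>\<sigma> ?P\<close> occurs once positively, from the arrivals, and
    \<open>1 + \<rho>\<close> times negatively, from the phase length; what is left has the right
    sign.\<close>
  moreover have "0 \<le> \<rho> * \<sigma> ?P" using \<rho> \<sigma>_bounds(1)[of ?P] by simp
  ultimately show "real (R - ?Q) + real (?Q - ?P) \<le> 4 / (1 - \<rho>) * real n + \<beta> * (1 + \<rho>)"
    using arrivals_tokens[OF starts(1), of t] \<sigma>_bounds(1)[of ?Q] W W_le
    by (simp add: algebra_simps)
qed

section \<open>Bounds for small rates\<close>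

context
  fixes g :: nat
  assumes \<beta>_int: "\<beta> \<in> \<int>" and g: "g = 1 + nat (lg (real n))" and slow: "\<rho> * real (1 + g) \<le> 1"
begin

text \<open>Both \<open>k\<close> and \<open>\<beta>\<close> are integers and
  \<open>\<rho> < 1\<close>, so the excess \<open>\<rho>\<close> rounds away.\<close>

private lemma le_\<beta>: "real k \<le> \<beta> + \<rho> \<Longrightarrow> real k \<le> \<beta>"
proof -
  assume k: "real k \<le> \<beta> + \<rho>"
  obtain b where b: "\<beta> = of_int b" using \<beta>_int by (auto elim: Ints_cases)
  with k \<rho> have "real_of_int (int k) < real_of_int (b + 1)" by simp
  then have "int k < b + 1" by (simp only: of_int_less_iff)
  with b show ?thesis by simp
qed

text \<open>Carries the bound \<open>\<beta> + \<rho>\<close> from one phase to the next, or to any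
  round \<open>u\<close> of an unfinished one: \<open>k \<ge> 1\<close> packets take at most
  \<open>k * (1 + g)\<close> rounds, which earn at most \<open>k\<close> new tokens.\<close>

private lemma next_arrivals:
  assumes "real k + \<sigma> Q \<le> \<beta> + \<rho>" and "Q \<le> u" and "u - Q \<le> log_cost n k"
  shows "real (arrivals n adv Q u) + \<sigma> u \<le> \<beta> + \<rho>"
proof -
  have "\<rho> * real (u - Q) \<le> \<rho> * real (1 + k * g)"
    using assms(3) \<rho> unfolding log_cost_def g
    by (intro mult_left_mono) (simp_all only: of_nat_le_iff less_imp_le)
  also have "\<rho> * real (1 + k * g) + \<sigma> Q \<le> \<beta> + \<rho>"
  \<comment> \<open>A phase without old packets may still take one round; its refill is the source
    of the extra \<open>\<rho>\<close>.\<close>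
  proof (cases "k = 0")
    case True
    then show ?thesis using \<sigma>_bounds(2)[of Q] by simp
  next
    case False
    then have "\<rho> * real (1 + k * g) \<le> \<rho> * real (k * (1 + g))"
      using \<rho> by (intro mult_left_mono) (simp_all only: of_nat_le_iff less_imp_le, simp)
    also have "\<dots> \<le> real k * 1"
      using mult_left_mono[OF slow, of "real k"] by (simp add: algebra_simps)
    finally show ?thesis using assms(1) by simp
  qed
  finally show ?thesis using arrivals_tokens[OF assms(2)] by simp
qed

private lemma log_cost_le:
  assumes "real k \<le> \<beta>" shows "real (log_cost n k) \<le> \<beta> * real (1 + g)"
proof -
  have "real k * real g \<le> \<beta> * real g" using assms by (intro mult_right_mono) auto
  \<comment> \<open>The summand 1 of the cost is absorbed by \<open>\<beta> \<ge> 1\<close>.\<close>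
  with \<beta> show ?thesis unfolding log_cost_def g[symmetric] by (simp add: algebra_simps)
qed

private lemma phase_length_slow:
  "real (cur_start (c t) - prev_start (c t)) \<le> \<beta> * real (1 + g)
    \<and> real (old_arrivals t) + \<sigma> (cur_start (c t)) \<le> \<beta> + \<rho>"
  using mid n
proof (induction t rule: phase_induct)
  case init
  show ?case using \<rho> \<beta> by (simp add: arrivals_def)
next
  case (step P Q R)
  have "real (arrivals n adv P Q) \<le> \<beta>"
    using step(1) \<sigma>_bounds(1)[of Q] by (intro le_\<beta>) linarith
  moreover have "R - Q \<le> log_cost n (arrivals n adv P Q)" using step(4) search_cost_log by blast
  ultimately show ?case
    using log_cost_le next_arrivals[of "arrivals n adv P Q" Q R] step(1,3)
    by (meson less_imp_le of_nat_le_iff order_trans)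
qed

private lemmas old_arrivals_tokens = phase_length_slow[THEN conjunct2]

private lemma old_arrivals_le_\<beta>: "real (old_arrivals t) \<le> \<beta>"
  using le_\<beta> old_arrivals_tokens[of t] \<sigma>_bounds(1)[of "cur_start (c t)"] by (simp add: order_trans)

lemma total_queued_bound_slow: "real (total_queued n mid adv t) \<le> 2 * \<beta>"
proof -
  have "t - cur_start (c t) \<le> log_cost n (old_arrivals t)"
    using old_load_le(2)[OF mid n search_cost_log, of adv t] by linarith
  \<comment> \<open>Applied to the current phase cut off at \<open>t\<close>; old and new packets
    then contribute at most \<open>\<beta>\<close> each.\<close>
  from next_arrivals[OF old_arrivals_tokens starts(2) this]
  have "real (arrivals n adv (cur_start (c t)) t) \<le> \<beta>"
    using \<sigma>_bounds(1)[of t] by (intro le_\<beta>) linarith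
  then show ?thesis
    using total_queued_le[OF mid n, of adv t] old_load_le(1)[OF mid n, of adv t]
      old_arrivals_le_\<beta>[of t] by linarith
qed

lemma latency_bound_slow: "latency_at_most n mid adv (2 * \<beta> * real (1 + g))"
proof (rule latency_if_two_phases)
  fix t R
  assume "\<forall>f. search_cost f \<longrightarrow> R - cur_start (c t) \<le> f n (old_arrivals t)"
  then have "R - cur_start (c t) \<le> log_cost n (old_arrivals t)" using search_cost_log by blast
  then have "real (R - cur_start (c t)) \<le> \<beta> * real (1 + g)"
    using log_cost_le[OF old_arrivals_le_\<beta>[of t]] by linarith
  then show "real (R - cur_start (c t)) + real (cur_start (c t) - prev_start (c t))
      \<le> 2 * \<beta> * real (1 + g)"
    using phase_length_slow[of t] by linarith
qed

end

end

theorem theorem3: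
  fixes n :: nat and \<rho> :: real and \<beta> :: int
    and mid adv :: "nat \<Rightarrow> nat \<Rightarrow> nat"
  assumes "1 \<le> n" and "0 < \<rho>" and "\<rho> < 1" and "1 \<le> \<beta>"
    and "halving mid"
    and "leaky_bucket \<rho> (real_of_int \<beta>) n adv"
  shows "(\<forall>t. real (total_queued n mid adv t) \<le> 4 * \<rho> / (1 - \<rho>) * real n + real_of_int \<beta>)
    \<and> latency_at_most n mid adv (4 / (1 - \<rho>) * real n + real_of_int \<beta> * (1 + \<rho>))
    \<and> (\<rho> \<le> 1 / (2 + real_of_int (lg (real n))) \<longrightarrow>
         (\<forall>t. real (total_queued n mid adv t) \<le> 2 * real_of_int \<beta>)
         \<and> latency_at_most n mid adv (2 * real_of_int \<beta> * (2 + real_of_int (lg (real n)))))"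
proof -
  have \<beta>: "1 \<le> real_of_int \<beta>" using assms(4) by simp
  note args = assms(1-3) \<beta> assms(5,6)
  define g where "g = 1 + nat (lg (real n))"
  have "0 \<le> lg (real n)" using lg_nonneg assms(1) by simp
  \<comment> \<open>As \<open>lg n\<close> is not negative, \<open>nat\<close> in \<open>g\<close>
    loses nothing.\<close>
  then have g: "2 + real_of_int (lg (real n)) = real (1 + g)" by (simp add: g_def)
  have "\<rho> * real (1 + g) \<le> 1" if "\<rho> \<le> 1 / (2 + real_of_int (lg (real n)))"
    using that unfolding g by (simp add: field_simps)
  then show ?thesis
    unfolding g using total_queued_bound[OF args] latency_bound[OF args]
      total_queued_bound_slow[OF args Ints_of_int g_def]
      latency_bound_slow[OF args Ints_of_int g_def] by (simp add: g)
qed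

end
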